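(* Let $\mathcal U\subset\mathbb R$ be a fixed finite set, let $\mathcal V=\mathcal U-\mathcal U$ and let $K\ge 1$ be a fixed integer. For $a\in\mathbb R$ consider the system $x(k+1)=ax(k)+u(k)$, $y(k)=\lfloor x(k)\rfloor$ with inputs $u(k)\in\mathcal U$. Let $E_K$ be the set of real algebraic numbers $a$ of degree at most $K$ for which ULDI is not equivalent to ULI for this system (i.e. exactly one of the two properties holds). Then $E_K$ is discrete except for possibly two accumulation points: every accumulation point $a\in\mathbb R$ of $E_K$ satisfies $$|a|=\min_{0\neq v\in\mathcal V}|v|-1 .$$ Therefore, for any fixed $\delta>0$, the set of $a\in E_K$ such that $$\Big|\,|a|-\Big(\min_{0\neq v\in\mathcal V}|v|-1\Big)\Big|>\delta$$ is finite.
   Context: System: given $a\in\mathbb R$ and a finite set $\mathcal U\subset\mathbb R$, consider $x(k+1)=ax(k)+u(k)$, $y(k)=\lfloor x(k)\rfloor$, with state $x(k)\in\mathbb R$, input $u(k)\in\mathcal U$, output $y(k)\in\mathbb Z$. For $x_0\in\mathbb R$ and inputs $u_1,u_2,\ldots\in\mathcal U$, run the system from $x(1)=x_0$ with $u(k)=u_k$ for $k\ge1$, and let $f_{k_1}^{k_2}(x_0,u_1,\ldots,u_{k_2})=(y(k_1),\ldots,y(k_2))$. ULI: for $k\in\mathbb N$, the system is uniformly left invertible (ULI) in $k$ steps if there is a constant $l\in\mathbb N$ such that for every pair of distinct input sequences $\{u_i\},\{u_i'\}$ in $\mathcal U$, all $(x_0,x_0')\in\mathbb R^2$ and all $m>l$: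 $u_m\ne u_m'$ implies $f_m^{m+k}(x_0,u_1,\ldots,u_{m+k})\ne f_m^{m+k}(x_0',u_1',\ldots,u_{m+k}')$. The system is ULI if it is ULI in $k$ steps for some $k\in\mathbb N$. ULDI: let $\mathcal V=\mathcal U-\mathcal U=\{u-u':u,u'\in\mathcal U\}$. The difference system is $z(k+1)=az(k)+v(k)$ with $z(k)\in\mathbb R$, $v(k)\in\mathcal V$; let $D_{k_1}^{k_2}(z_0,v_1,\ldots,v_{k_2})=(z(k_1),\ldots,z(k_2))$ be generated from $z(1)=z_0$ with $v(k)=v_k$. The system is uniformly left D-invertible (ULDI) in $k$ steps if there is a constant $l\in\mathbb N$ such that for every pair of distinct input sequences $\{u_i\},\{u_i'\}$ in $\mathcal U$, with $v_i=u_i-u_i'$, all $z_0\in\mathbb R$ and all $m>l$: $v_m\neq0$ implies $D_m^{m+k}(z_0,v_1,\ldots,v_{m+k})\notin\,]-1,1[^{k+1}$. The system is ULDI if it is ULDI in $k$ steps for some $k\in\mathbb N$. *)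

theory Defs
  imports "HOL-Analysis.Analysis" "HOL-Computational_Algebra.Computational_Algebra"
begin

(* Time starts at 1; the value at time 0 is a dummy, and the entry of an input sequence at
   index 0 is never used.  The same recursion drives the original and the difference system. *)
primrec traj :: "real \<Rightarrow> real \<Rightarrow> (nat \<Rightarrow> real) \<Rightarrow> nat \<Rightarrow> real" where
  "traj a x0 u 0 = x0"
| "traj a x0 u (Suc k) = (if k = 0 then x0 else a * traj a x0 u k + u k)"

definition input_seq :: "real set \<Rightarrow> (nat \<Rightarrow> real) \<Rightarrow> bool" where
  "input_seq U u \<longleftrightarrow> (\<forall>i\<ge>1. u i \<in> U)"

definition distinct_seqs :: "(nat \<Rightarrow> real) \<Rightarrow> (nat \<Rightarrow> real) \<Rightarrow> bool" where
  "distinct_seqs u u' \<longleftrightarrow> (\<exists>i\<ge>1. u i \<noteq> u' i)"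

definition outputs :: "real \<Rightarrow> nat \<Rightarrow> nat \<Rightarrow> real \<Rightarrow> (nat \<Rightarrow> real) \<Rightarrow> int list" where
  "outputs a k1 k2 x0 u = map (\<lambda>k. \<lfloor>traj a x0 u k\<rfloor>) [k1..<Suc k2]"

definition diff_states :: "real \<Rightarrow> nat \<Rightarrow> nat \<Rightarrow> real \<Rightarrow> (nat \<Rightarrow> real) \<Rightarrow> real list" where
  "diff_states a k1 k2 z0 v = map (traj a z0 v) [k1..<Suc k2]"

definition open_cube :: "nat \<Rightarrow> real list set" where
  "open_cube n = {w. length w = n \<and> set w \<subseteq> {-1<..<1}}"

definition ULI_in :: "nat \<Rightarrow> real \<Rightarrow> real set \<Rightarrow> bool" where
  "ULI_in k a U \<longleftrightarrow>
     (\<exists>l::nat. \<forall>u u'. input_seq U u \<and> input_seq U u' \<and> distinct_seqs u u' \<longrightarrow>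
        (\<forall>x0 x0'. \<forall>m>l. u m \<noteq> u' m \<longrightarrow>
           outputs a m (m + k) x0 u \<noteq> outputs a m (m + k) x0' u'))"

definition ULI :: "real \<Rightarrow> real set \<Rightarrow> bool" where
  "ULI a U \<longleftrightarrow> (\<exists>k. ULI_in k a U)"

definition ULDI_in :: "nat \<Rightarrow> real \<Rightarrow> real set \<Rightarrow> bool" where
  "ULDI_in k a U \<longleftrightarrow>
     (\<exists>l::nat. \<forall>u u'. input_seq U u \<and> input_seq U u' \<and> distinct_seqs u u' \<longrightarrow>
        (let v = (\<lambda>i. u i - u' i) in
          \<forall>z0. \<forall>m>l. v m \<noteq> 0 \<longrightarrow> diff_states a m (m + k) z0 v \<notin> open_cube (k + 1)))"

definition ULDI :: "real \<Rightarrow> real set \<Rightarrow> bool" where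
  "ULDI a U \<longleftrightarrow> (\<exists>k. ULDI_in k a U)"

definition diff_set :: "real set \<Rightarrow> real set" where
  "diff_set U = {u - u' | u u'. u \<in> U \<and> u' \<in> U}"

(* If U has at most one element, this is Min {} and hence unspecified; in that case there are
   no distinct input sequences, so ULI and ULDI both hold for every a. *)
definition min_gap :: "real set \<Rightarrow> real" where
  "min_gap U = Min {\<bar>v\<bar> | v. v \<in> diff_set U \<and> v \<noteq> 0}"

(* Degree of the minimal polynomial over the rationals; meaningful for algebraic a only. *)
definition alg_degree :: "real \<Rightarrow> nat" where
  "alg_degree a =
     (LEAST n. \<exists>p :: rat poly. p \<noteq> 0 \<and> poly (map_poly of_rat p) a = 0 \<and> degree p = n)"

definition exceptional_set :: "nat \<Rightarrow> real set \<Rightarrow> real set" where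
  "exceptional_set K U =
     {a. algebraic a \<and> alg_degree a \<le> K \<and> \<not> (ULDI a U \<longleftrightarrow> ULI a U)}"

end

theory Submission
  imports Defs "HOL-Analysis.Kronecker_Approximation_Theorem"
begin

text \<open>
Write \<open>g\<close> for the smallest distance of two distinct inputs.  Equal outputs force the difference of the
two states into \<open>]-1,1[\<close>, so ULDI always implies ULI, and the question is when ULDI can fail while
ULI holds.

If \<open>\<bar>a\<bar> \<le> g - 1\<close>, a nonzero input difference expels the state difference from the unit interval
in a single step, so both properties hold.  If \<open>\<bar>a\<bar> > g - 1\<close>, the difference system
\<open>z(k+1) = a z(k) \<plusminus> g\<close> has an orbit with \<open>\<bar>z(k)\<bar> = g / (1 + \<bar>a\<bar>) < 1\<close> for all \<open>k\<close>: it is constant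
for negative \<open>a\<close> and alternates in sign for positive \<open>a\<close>.  To defeat ULI with this orbit one needs
two states \<open>X(k) \<plusminus> z(k) / 2\<close> with the same integer part throughout an arbitrarily long window.
The midpoints obey \<open>X(k+1) = a X(k) + \<mu>\<close> with constant \<open>\<mu>\<close>, so for \<open>a \<noteq> 1\<close> they are
\<open>X(k) = x + \<xi> a^k\<close> with fixed point \<open>x\<close> and free parameter \<open>\<xi>\<close>, and it suffices that \<open>\<xi> a^k\<close> stays
within a fixed \<open>\<epsilon>\<close> of a given number \<open>\<theta>\<close> modulo 1.  Here \<open>\<epsilon>\<close> depends only on \<open>g\<close> and on how far
\<open>\<bar>a\<bar>\<close> exceeds \<open>g - 1\<close>.

Let \<open>P\<close> be the primitive integer polynomial of least degree \<open>d\<close> with root \<open>a\<close>.  The central claim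
(\<open>powers_near_prescribed_residue\<close>) is that such a \<open>\<xi>\<close> exists, for every window length, as soon as
the sum of the absolute coefficients of \<open>P\<close> exceeds a bound that depends only on \<open>d\<close> and \<open>\<epsilon>\<close>.
Since only finitely many integer polynomials of degree at most \<open>K\<close> have coefficients below such a
bound, only finitely many exceptional \<open>a\<close> can have \<open>\<bar>a\<bar>\<close> at distance more than \<open>\<delta>\<close> from \<open>g - 1\<close>, and
the statement on accumulation points follows.

For the central claim, let \<open>P(S)\<close> be the polynomial \<open>P\<close> in the shift \<open>S\<close> of sequences.  One looks for a
sequence \<open>w = N + \<theta> + e\<close> with \<open>N\<close> integral, \<open>e\<close> small and \<open>P(S) w = 0\<close>.  Three facts, each for finite windows of arbitrary length with
bounds that do not depend on the length, yield it:

\<^item> There is a small real \<open>e\<close> with \<open>P(S) e\<close> prescribed modulo 1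
  (\<open>shift_op_small_solution_mod_Ints\<close>).  If no root of \<open>P\<close> is large, the leading coefficient is
  comparable with the norm and \<open>e\<close> can be chosen greedily; factors belonging to large roots are
  inverted backwards in time at a bounded cost.

\<^item> \<open>P(S)\<close> maps integer sequences onto integer sequences (\<open>shift_op_surj_int\<close>), because \<open>P\<close> is
  nonzero modulo every prime.

\<^item> Every real \<open>w\<close> with \<open>P(S) w = 0\<close> is close, modulo 1, to a geometric sequence \<open>\<xi> a^i\<close>
  (\<open>recurrent_sequence_near_geometric\<close>), by Kronecker's theorem for the linearly independent numbers
  \<open>1, a, \<dots>, a^(d-1)\<close>.
\<close>

section \<open>Polynomials in the shift operator\<close>

definition shift_op :: "'a :: comm_ring_1 poly \<Rightarrow> (nat \<Rightarrow> 'a) \<Rightarrow> nat \<Rightarrow> 'a" where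
  "shift_op p e i = (\<Sum>j\<le>degree p. coeff p j * e (i + j))"

lemma shift_op_extend:
  assumes "degree p \<le> n"
  shows "shift_op p e i = (\<Sum>j\<le>n. coeff p j * e (i + j))"
  unfolding shift_op_def
  by (rule sum.mono_neutral_left) (use assms in \<open>auto simp: coeff_eq_0\<close>)

lemma shift_op_0 [simp]: "shift_op 0 e = (\<lambda>_. 0)"
  by (auto simp: shift_op_def)

lemma shift_op_pCons: "shift_op (pCons c p) e i = c * e i + shift_op p e (Suc i)"
proof -
  have "shift_op (pCons c p) e i = (\<Sum>j\<le>Suc (degree p). coeff (pCons c p) j * e (i + j))"
    by (rule shift_op_extend) (rule degree_pCons_le)
  also have "\<dots> = c * e i + shift_op p e (Suc i)"
    by (subst sum.atMost_Suc_shift) (simp add: shift_op_def)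
  finally show ?thesis .
qed

lemma shift_op_add: "shift_op (p + q) e i = shift_op p e i + shift_op q e i"
proof -
  let ?n = "max (degree p) (degree q)"
  have "shift_op (p + q) e i = (\<Sum>j\<le>?n. coeff (p + q) j * e (i + j))"
    by (rule shift_op_extend) (rule degree_add_le_max)
  then show ?thesis
    by (simp add: shift_op_extend [of p ?n] shift_op_extend [of q ?n] distrib_right sum.distrib)
qed

lemma shift_op_smult: "shift_op (smult c p) e i = c * shift_op p e i"
  by (subst shift_op_extend [OF degree_smult_le])
     (simp add: shift_op_def sum_distrib_left mult.assoc)

lemma shift_op_cong: "(\<And>j. j \<le> degree p \<Longrightarrow> e (i + j) = e' (i + j)) \<Longrightarrow> shift_op p e i = shift_op p e' i"
  by (simp add: shift_op_def)

lemma shift_op_mult: "shift_op (p * q) e i = shift_op p (shift_op q e) i"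
proof (induction p arbitrary: i)
  case (pCons c p)
  have "shift_op (pCons c p * q) e i = c * shift_op q e i + shift_op (p * q) e (Suc i)"
    by (simp add: shift_op_add shift_op_smult shift_op_pCons)
  with pCons.IH show ?case
    by (simp add: shift_op_pCons)
qed simp

lemma shift_op_plus: "shift_op p (\<lambda>i. e i + e' i) i = shift_op p e i + shift_op p e' i"
  by (simp add: shift_op_def distrib_left sum.distrib)

lemma shift_op_scale: "shift_op p (\<lambda>i. c * e i) i = c * shift_op p e i"
  by (simp add: shift_op_def sum_distrib_left algebra_simps)

lemma shift_op_const: "shift_op p (\<lambda>_. c) i = c * poly p 1"
  by (simp add: shift_op_def poly_altdef sum_distrib_left mult.commute)

lemma shift_op_power: "shift_op p (\<lambda>i. x ^ i) i = x ^ i * poly p x"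
  by (simp add: shift_op_def poly_altdef sum_distrib_left power_add algebra_simps)

lemma shift_op_of_int:
  "shift_op (map_poly real_of_int p) (\<lambda>i. real_of_int (e i)) i = real_of_int (shift_op p e i)"
  by (simp add: shift_op_def coeff_map_poly degree_map_poly)

text \<open>
The two updating lemmas drive the constructions forward in time: the last entry seen by the
operator at time \<open>i\<close> can be changed freely without disturbing the earlier equations.
\<close>

lemma shift_op_upd_last:
  fixes p :: "'a :: comm_ring_1 poly"
  shows "shift_op p (e(i + degree p := x)) i
       = lead_coeff p * x + (\<Sum>j<degree p. coeff p j * e (i + j))"
  by (simp add: shift_op_def lessThan_Suc_atMost [symmetric])

lemma shift_op_upd_later:
  assumes "i' < i"
  shows "shift_op p (e(i + degree p := x)) i' = shift_op p e i'"
  by (rule shift_op_cong) (use assms in auto)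

section \<open>Integer solutions for primitive polynomials\<close>

text \<open>
Modulo \<open>p\<close> the polynomial may lose its upper coefficients.  The largest index \<open>j\<close> whose coefficient
survives takes the role of the degree: adjusting the entry at \<open>n + j\<close> corrects the equation at time
\<open>n\<close> and changes the earlier ones by multiples of \<open>p\<close> only.
\<close>

lemma shift_op_solve_mod_prime:
  fixes P :: "int poly" and p :: int
  assumes p: "prime p" and ex: "\<exists>j. \<not> p dvd coeff P j"
  shows "\<exists>N. \<forall>i<n. p dvd f i - shift_op P N i"
proof -
  define j where "j = (GREATEST j. \<not> p dvd coeff P j)"
  have bd: "\<not> p dvd coeff P l \<Longrightarrow> l \<le> degree P" for l
    by (metis coeff_eq_0 dvd_0_right not_le)
  have j: "\<not> p dvd coeff P j"
    unfolding j_def using ex bd by (metis (mono_tags, lifting) GreatestI_ex_nat)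
  have j_max: "p dvd coeff P l" if "l > j" for l
    using Greatest_le_nat [of "\<lambda>j. \<not> p dvd coeff P j" l "degree P"] bd that
    unfolding j_def by fastforce
  have jd: "j \<le> degree P" using bd j by blast
  have "coprime p (coeff P j)" using p j by (simp add: prime_imp_coprime)
  then obtain c b where "b * p + c * coeff P j = 1"
    using bezout_int [of p "coeff P j"] by auto
  then have c: "1 - c * coeff P j = p * b"
    by (simp add: algebra_simps)
  show ?thesis
  proof (induction n)
    case (Suc n)
    then obtain N where N: "\<And>i. i < n \<Longrightarrow> p dvd f i - shift_op P N i" by blast
    define r where "r = f n - shift_op P N n"
    define N' where "N' = N(n + j := N (n + j) + c * r)"
    have diff: "shift_op P N' i = shift_op P N i + (if n + j - i \<le> degree P \<and> i \<le> n + j then coeff P (n + j - i) * (c * r) else 0)" for i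
    proof -
      have "shift_op P N' i = (\<Sum>l\<le>degree P. coeff P l * N (i + l) + (if l = n + j - i \<and> i \<le> n + j then coeff P l * (c * r) else 0))"
        unfolding shift_op_def N'_def by (rule sum.cong) (auto simp: algebra_simps)
      also have "\<dots> = shift_op P N i + (\<Sum>l\<le>degree P. (if l = n + j - i \<and> i \<le> n + j then coeff P l * (c * r) else 0))"
        by (simp add: sum.distrib shift_op_def)
      also have "(\<Sum>l\<le>degree P. (if l = n + j - i \<and> i \<le> n + j then coeff P l * (c * r) else 0)) = (if n + j - i \<le> degree P \<and> i \<le> n + j then coeff P (n + j - i) * (c * r) else 0)"
        by (cases "i \<le> n + j") (simp_all add: sum.delta)
      finally show ?thesis .
    qed
    have "p dvd f i - shift_op P N' i" if "i < Suc n" for i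
    proof (cases "i < n")
      case True
      then have "p dvd coeff P (n + j - i)" using j_max by simp
      with N [OF True] show ?thesis unfolding diff
        by (auto simp: algebra_simps dvd_diff_right_iff)
    next
      case False
      with that have [simp]: "i = n" by simp
      have "r - coeff P j * (c * r) = r * (1 - c * coeff P j)"
        by (simp add: algebra_simps)
      then have "p dvd r - coeff P j * (c * r)"
        by (simp add: c)
      then show ?thesis using jd unfolding diff by (simp add: r_def algebra_simps)
    qed
    then show ?case by blast
  qed simp
qed

text \<open>
Solutions modulo the prime factors of \<open>m\<close> are combined as digits: the error of a solution modulo \<open>p\<close>
is \<open>p\<close> times a new right-hand side, which is then solved modulo the cofactor.
\<close>

lemma shift_op_solve_mod:
  fixes P :: "int poly" and m :: int
  assumes prim: "\<And>p. prime p \<Longrightarrow> \<exists>j. \<not> p dvd coeff P j" and "m \<noteq> 0"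
  shows "\<exists>N. \<forall>i<n. m dvd f i - shift_op P N i"
  using \<open>m \<noteq> 0\<close>
proof (induction m arbitrary: f rule: prime_divisors_induct)
  case (factor p m)
  from factor.prems have "m \<noteq> 0" by auto
  obtain N1 where "\<forall>i<n. p dvd f i - shift_op P N1 i"
    using shift_op_solve_mod_prime prim factor.hyps by blast
  then have "\<forall>i. \<exists>g. i < n \<longrightarrow> f i - shift_op P N1 i = p * g" by (auto elim: dvdE)
  then obtain g where g: "\<And>i. i < n \<Longrightarrow> f i - shift_op P N1 i = p * g i" by metis
  obtain N2 where N2: "\<forall>i<n. m dvd g i - shift_op P N2 i"
    using factor.IH \<open>m \<noteq> 0\<close> by blast
  have "p * m dvd f i - shift_op P (\<lambda>i. N1 i + p * N2 i) i" if "i < n" for i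
  proof -
    have "f i - shift_op P (\<lambda>i. N1 i + p * N2 i) i = p * (g i - shift_op P N2 i)"
      using g [OF that] by (simp add: shift_op_plus shift_op_scale algebra_simps)
    with N2 that show ?thesis by simp
  qed
  then show ?case by blast
qed (auto simp: unit_imp_dvd)

text \<open>
Solving forward in time divides by the leading coefficient once per step, so a right-hand side
that is divisible by a power of it large enough for the whole window admits an integer solution.
\<close>

lemma shift_op_solve_multiple:
  fixes P :: "int poly"
  assumes "P \<noteq> 0" 
  shows "\<exists>N. \<forall>i<n. shift_op P N i = lead_coeff P ^ n * g i"
proof -
  let ?c = "lead_coeff P" and ?d = "degree P"
  \<comment> \<open>The invariant records the power of the leading coefficient that is still to be used up.\<close>
  have "\<exists>N. (\<forall>t. ?c ^ (n + ?d - Suc t) dvd N t) \<and> (\<forall>i<m. shift_op P N i = ?c ^ n * g i)"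
    if "m \<le> n" for m
    using that
  proof (induction m)
    case 0
    show ?case by (rule exI [of _ "\<lambda>_. 0"]) simp
  next
    case (Suc m)
    then obtain N where N: "\<And>t. ?c ^ (n + ?d - Suc t) dvd N t"
      "\<And>i. i < m \<Longrightarrow> shift_op P N i = ?c ^ n * g i" by auto
    have "?c ^ (n - m) dvd ?c ^ n * g m - (\<Sum>j<?d. coeff P j * N (m + j))"
    proof (rule dvd_diff)
      show "?c ^ (n - m) dvd ?c ^ n * g m"
        by (intro dvd_mult2 le_imp_power_dvd) simp
    next
      have "?c ^ (n - m) dvd N (m + j)" if "j < ?d" for j
      proof -
        have "?c ^ (n - m) dvd ?c ^ (n + ?d - Suc (m + j))"
          using that by (intro le_imp_power_dvd) auto
        then show ?thesis using N(1) dvd_trans by blast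
      qed
      then show "?c ^ (n - m) dvd (\<Sum>j<?d. coeff P j * N (m + j))"
        by (intro dvd_sum dvd_mult) auto
    qed
    moreover have "?c ^ (n - m) = ?c * ?c ^ (n - Suc m)"
      using Suc.prems by (metis Suc_diff_Suc Suc_le_lessD power_Suc)
    ultimately obtain y where y: "?c ^ n * g m - (\<Sum>j<?d. coeff P j * N (m + j)) = ?c * (?c ^ (n - Suc m) * y)"
      by (metis dvdE mult.assoc)
    define N' where "N' = N(m + ?d := ?c ^ (n - Suc m) * y)"
    have "?c ^ (n + ?d - Suc t) dvd N' t" for t
      using N(1) by (auto simp: N'_def)
    moreover have "shift_op P N' i = ?c ^ n * g i" if "i < Suc m" for i
    proof (cases "i = m")
      case True
      with y show ?thesis by (simp add: N'_def shift_op_upd_last)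
    next
      case False
      with that N(2) show ?thesis by (simp add: N'_def shift_op_upd_later)
    qed
    ultimately show ?case by blast
  qed
  then show ?thesis by blast
qed

text \<open>
The operator is onto modulo every prime because a primitive polynomial survives there.  Solving modulo the power of the leading coefficient needed above
leaves a remainder that forward recursion can handle.
\<close>

lemma shift_op_surj_int:
  fixes P :: "int poly"
  assumes prim: "\<And>p. prime p \<Longrightarrow> \<exists>j. \<not> p dvd coeff P j" and "P \<noteq> 0"
  shows "\<exists>N. \<forall>i<n. shift_op P N i = f i"
proof -
  let ?m = "lead_coeff P ^ n"
  obtain N1 where "\<forall>i<n. ?m dvd f i - shift_op P N1 i"
    using shift_op_solve_mod [OF prim, of ?m n f] \<open>P \<noteq> 0\<close> by auto
  then have "\<forall>i. \<exists>g. i < n \<longrightarrow> f i - shift_op P N1 i = ?m * g" by (auto elim: dvdE)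
  then obtain g where g: "\<And>i. i < n \<Longrightarrow> f i - shift_op P N1 i = ?m * g i" by metis
  obtain N2 where "\<forall>i<n. shift_op P N2 i = ?m * g i"
    using shift_op_solve_multiple [OF \<open>P \<noteq> 0\<close>] by blast
  with g have "\<forall>i<n. shift_op P (\<lambda>i. N1 i + N2 i) i = f i"
    by (force simp: shift_op_plus)
  then show ?thesis by blast
qed

section \<open>The l1 norm of a polynomial\<close>

definition l1_norm :: "'a :: real_normed_field poly \<Rightarrow> real" where
  "l1_norm p = (\<Sum>j\<le>degree p. norm (coeff p j))"

lemma l1_norm_extend:
  assumes "degree p \<le> n"
  shows "l1_norm p = (\<Sum>j\<le>n. norm (coeff p j))"
  unfolding l1_norm_def
  by (rule sum.mono_neutral_left) (use assms in \<open>auto simp: coeff_eq_0\<close>)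

lemma l1_norm_pCons: "l1_norm (pCons c p) = norm c + l1_norm p"
proof -
  have "l1_norm (pCons c p) = (\<Sum>j\<le>Suc (degree p). norm (coeff (pCons c p) j))"
    by (rule l1_norm_extend) (rule degree_pCons_le)
  also have "\<dots> = norm c + l1_norm p"
    by (subst sum.atMost_Suc_shift) (simp add: l1_norm_def)
  finally show ?thesis .
qed

lemma l1_norm_0 [simp]: "l1_norm 0 = 0"
  by (simp add: l1_norm_def)

lemma l1_norm_nonneg: "0 \<le> l1_norm p"
  by (simp add: l1_norm_def sum_nonneg)

lemma norm_coeff_le_l1_norm: "norm (coeff p i) \<le> l1_norm p"
  unfolding l1_norm_extend [of p "max i (degree p)", simplified]
  by (rule member_le_sum) auto

lemma l1_norm_pos: "p \<noteq> 0 \<Longrightarrow> 0 < l1_norm p"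
  using norm_coeff_le_l1_norm [of p "degree p"] by (smt (verit) leading_coeff_0_iff zero_less_norm_iff)

lemma l1_norm_smult: "l1_norm (smult c p) = norm c * l1_norm p"
  by (subst l1_norm_extend [OF degree_smult_le])
     (simp add: l1_norm_def sum_distrib_left norm_mult)

lemma l1_norm_add_le: "l1_norm (p + q) \<le> l1_norm p + l1_norm q"
proof -
  let ?n = "max (degree p) (degree q)"
  have "l1_norm (p + q) = (\<Sum>j\<le>?n. norm (coeff (p + q) j))"
    by (rule l1_norm_extend) (rule degree_add_le_max)
  also have "\<dots> \<le> (\<Sum>j\<le>?n. norm (coeff p j) + norm (coeff q j))"
    by (intro sum_mono) (simp add: norm_triangle_ineq)
  finally show ?thesis
    by (simp add: l1_norm_extend [of p ?n] l1_norm_extend [of q ?n] sum.distrib)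
qed

lemma l1_norm_mult_le: "l1_norm (p * q) \<le> l1_norm p * l1_norm q"
proof (induction p)
  case (pCons c p)
  have "l1_norm (pCons c p * q) \<le> l1_norm (smult c q) + l1_norm (pCons 0 (p * q))"
    by (simp add: l1_norm_add_le)
  with pCons.IH show ?case
    by (simp add: l1_norm_pCons l1_norm_smult algebra_simps)
qed simp

lemma l1_norm_of_real: "l1_norm (map_poly complex_of_real p) = l1_norm p"
  by (simp add: l1_norm_def degree_map_poly coeff_map_poly)

text \<open>
The polynomial is its leading coefficient times factors \<open>X - z\<close> of norm at most \<open>1 + R\<close>, and the norm
is submultiplicative.
\<close>

lemma l1_norm_le_lead_coeff:
  fixes p :: "complex poly"
  assumes "\<And>z. poly p z = 0 \<Longrightarrow> norm z \<le> R" and R: "R \<ge> 0"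
  shows "l1_norm p \<le> norm (lead_coeff p) * (1 + R) ^ degree p"
  using assms(1)
proof (induction "degree p" arbitrary: p)
  case 0
  then show ?case by (simp add: l1_norm_def)
next
  case (Suc n)
  then obtain z where z: "poly p z = 0"
    using fundamental_theorem_of_algebra [of p] by (metis constant_degree nat.distinct(1))
  then obtain q where q: "p = [:- z, 1:] * q"
    by (auto simp: poly_eq_0_iff_dvd elim: dvdE)
  with Suc.hyps(2) have q0: "q \<noteq> 0" by auto
  have deg: "degree p = Suc (degree q)" unfolding q using q0 by (subst degree_mult_eq) auto
  have lc: "lead_coeff p = lead_coeff q" unfolding q by (simp only: lead_coeff_mult) simp
  have IH: "l1_norm q \<le> norm (lead_coeff q) * (1 + R) ^ degree q"
    by (rule Suc.hyps(1)) (use deg Suc q in auto)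
  have "l1_norm p \<le> l1_norm [:- z, 1:] * l1_norm q" unfolding q by (rule l1_norm_mult_le)
  also have "\<dots> \<le> (1 + R) * l1_norm q"
    using Suc.prems [OF z] l1_norm_nonneg [of q] by (intro mult_right_mono) (simp_all add: l1_norm_pCons)
  also have "\<dots> \<le> (1 + R) * (norm (lead_coeff q) * (1 + R) ^ degree q)"
    using IH R by (intro mult_left_mono) auto
  finally show ?case unfolding lc unfolding deg by (simp add: algebra_simps)
qed

section \<open>Small real solutions modulo the integers\<close>

text \<open>
Whatever the earlier entries contribute, the newest entry only has to make up for a fractional part,
so its size is bounded by the inverse of the leading coefficient; errors cannot accumulate.
\<close>

lemma shift_op_greedy_mod_Ints:
  fixes p :: "real poly" and s :: "nat \<Rightarrow> real"
  assumes "p \<noteq> 0"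
  shows "\<exists>e. (\<forall>i. \<bar>e i\<bar> \<le> 1 / \<bar>lead_coeff p\<bar>) \<and> (\<forall>i<n. shift_op p e i - s i \<in> \<int>)"
proof (induction n)
  case 0
  show ?case by (rule exI [of _ "\<lambda>_. 0"]) simp
next
  case (Suc n)
  let ?c = "lead_coeff p" and ?d = "degree p"
  obtain e where e: "\<And>i. \<bar>e i\<bar> \<le> 1 / \<bar>?c\<bar>" "\<And>i. i < n \<Longrightarrow> shift_op p e i - s i \<in> \<int>"
    using Suc by auto
  define t where "t = s n - (\<Sum>j<?d. coeff p j * e (n + j))"
  define e' where "e' = e(n + ?d := frac t / ?c)"
  have "\<bar>frac t\<bar> \<le> 1" using frac_lt_1 [of t] frac_ge_0 [of t] by simp
  then have "\<bar>frac t / ?c\<bar> \<le> 1 / \<bar>?c\<bar>"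
    using assms by (simp add: abs_divide divide_right_mono)
  with e(1) have "\<bar>e' i\<bar> \<le> 1 / \<bar>?c\<bar>" for i by (simp add: e'_def)
  moreover have "shift_op p e' i - s i \<in> \<int>" if "i < Suc n" for i
  proof (cases "i = n")
    case True
    have "shift_op p e' n = frac t + (s n - t)"
      using assms unfolding e'_def shift_op_upd_last by (simp add: t_def)
    then have "shift_op p e' n - s n = - of_int \<lfloor>t\<rfloor>" by (simp add: frac_def)
    with True show ?thesis by simp
  next
    case False
    with that e(2) show ?thesis by (simp add: e'_def shift_op_upd_later)
  qed
  ultimately show ?case by blast
qed

lemma abs_shift_op_le:
  fixes p :: "real poly"
  assumes "\<And>i. \<bar>e i\<bar> \<le> \<rho>"
  shows "\<bar>shift_op p e i\<bar> \<le> l1_norm p * \<rho>"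
proof -
  have "\<bar>shift_op p e i\<bar> \<le> (\<Sum>j\<le>degree p. \<bar>coeff p j * e (i + j)\<bar>)"
    unfolding shift_op_def by (rule sum_abs)
  also have "\<dots> \<le> (\<Sum>j\<le>degree p. \<bar>coeff p j\<bar> * \<rho>)"
    using assms by (intro sum_mono) (simp add: abs_mult mult_left_mono)
  finally show ?thesis by (simp add: l1_norm_def sum_distrib_right)
qed

text \<open>
Such a \<open>q\<close> is a perturbation of the constant 1 with total weight at most one half.  Filling the
entries from the end of the window towards its beginning is a stable recursion, since the
influence of the later entries is at most halved.
\<close>

lemma shift_op_solve_backward:
  fixes q :: "real poly"
  assumes q0: "coeff q 0 = 1" and q: "l1_norm q \<le> 3/2" and g: "\<And>i. \<bar>g i\<bar> \<le> \<rho>"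
  shows "\<exists>e. (\<forall>i. \<bar>e i\<bar> \<le> 2 * \<rho>) \<and> (\<forall>i<n. shift_op q e i = g i)"
proof -
  obtain q' where q': "q = pCons 1 q'" using q0 by (cases q) auto
  with q have l1: "l1_norm q' \<le> 1/2" by (simp add: l1_norm_pCons)
  have \<rho>: "\<rho> \<ge> 0" using g [of 0] by linarith
  have "\<exists>e. (\<forall>i. \<bar>e i\<bar> \<le> 2 * \<rho>) \<and> (\<forall>i<n. n - m \<le> i \<longrightarrow> shift_op q e i = g i)" if "m \<le> n" for m
    using that
  proof (induction m)
    case 0
    show ?case by (rule exI [of _ "\<lambda>_. 0"]) (use \<rho> in auto)
  next
    case (Suc m)
    then obtain e where e: "\<And>i. \<bar>e i\<bar> \<le> 2 * \<rho>"
      "\<And>i. i < n \<Longrightarrow> n - m \<le> i \<Longrightarrow> shift_op q e i = g i" by auto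
    define k where "k = n - Suc m"
    define e' where "e' = e(k := g k - shift_op q' e (Suc k))"
    have tail: "shift_op q' e' (Suc i) = shift_op q' e (Suc i)" if "i \<ge> k" for i
      by (rule shift_op_cong) (use that in \<open>auto simp: e'_def\<close>)
    have "\<bar>shift_op q' e (Suc k)\<bar> \<le> l1_norm q' * (2 * \<rho>)"
      using e(1) by (rule abs_shift_op_le)
    also have "\<dots> \<le> 1/2 * (2 * \<rho>)" using l1 \<rho> by (intro mult_right_mono) auto
    finally have "\<bar>e' k\<bar> \<le> 2 * \<rho>" using g [of k] by (simp add: e'_def)
    then have "\<bar>e' i\<bar> \<le> 2 * \<rho>" for i using e(1) by (simp add: e'_def)
    moreover have "shift_op q e' i = g i" if "i < n" "n - Suc m \<le> i" for i
    proof (cases "i = k")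
      case True
      then show ?thesis by (simp add: q' shift_op_pCons tail) (simp add: e'_def)
    next
      case False
      with that have "k < i" "n - m \<le> i" by (auto simp: k_def)
      then show ?thesis
        using e(2) [OF \<open>i < n\<close>] by (simp add: q' shift_op_pCons tail) (simp add: e'_def)
    qed
    ultimately show ?case by blast
  qed
  from this [of n] show ?thesis by auto
qed

lemma map_poly_of_real_add:
  "map_poly complex_of_real (p + q) = map_poly complex_of_real p + map_poly complex_of_real q"
  by (intro poly_eqI) (simp add: coeff_map_poly)

lemma map_poly_of_real_mult:
  "map_poly complex_of_real (p * q) = map_poly complex_of_real p * map_poly complex_of_real q"
  by (intro poly_eqI) (simp add: coeff_map_poly coeff_mult)

text \<open>
A root of large absolute value contributes a factor \<open>1 - X / z\<close>, or the product of two conjugate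
ones, which is real and close to the constant 1.  With the threshold 8 the non-constant coefficients
add up to at most one half, as the backward recursion requires.
\<close>

lemma split_off_large_root:
  fixes p :: "real poly" and z :: complex
  assumes z: "poly (map_poly complex_of_real p) z = 0" and large: "norm z > 8" and "p \<noteq> 0"
  obtains q r where "p = q * r" "coeff q 0 = 1" "degree q > 0" "l1_norm q \<le> 3/2"
proof (cases "Im z = 0")
  case True
  then obtain b where b: "z = of_real b" by (metis complex_is_Real_iff Reals_cases)
  have "complex_of_real (poly p b) = 0"
    using z unfolding b by (simp add: poly_altdef coeff_map_poly degree_map_poly)
  then have "poly p b = 0" by simp
  then obtain r where r: "p = [:- b, 1:] * r" by (auto simp: poly_eq_0_iff_dvd elim: dvdE)
  have b8: "\<bar>b\<bar> > 8" using large b by simp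
  show ?thesis
  proof (rule that)
    show "p = [:1, - 1 / b:] * smult (- b) r" using b8 r by (auto simp: algebra_simps)
    show "l1_norm [:1, - 1 / b:] \<le> 3/2" using b8 by (simp add: l1_norm_pCons field_simps)
  qed (use b8 in auto)
next
  case False
  \<comment> \<open>The minimal polynomial of \<open>z\<close> over the reals; it divides \<open>p\<close> because a linear real remainder
    cannot vanish at the non-real \<open>z\<close>.\<close>
  define m where "m = [:(norm z)\<^sup>2, - 2 * Re z, 1:]"
  have "cmod z * cmod z = Re z * Re z + Im z * Im z"
    using cmod_power2 [of z] by (simp add: power2_eq_square)
  then have mz: "poly (map_poly complex_of_real m) z = 0"
    by (simp add: m_def complex_eq_iff power2_eq_square algebra_simps map_poly_pCons)
  define r where "r = p mod m"
  have m0: "m \<noteq> 0" by (simp add: m_def)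
  obtain t where pm: "p = m * t + r" unfolding r_def by (metis mult_div_mod_eq)
  have "degree r < degree m"
    using degree_mod_less' [of m p] m0 by (cases "r = 0") (auto simp: r_def m_def)
  then have "degree r \<le> 1" by (simp add: m_def)
  then have r: "r = [:coeff r 0, coeff r 1:]"
    by (intro poly_eqI) (auto simp: coeff_pCons coeff_eq_0 split: nat.split)
  define c0 where "c0 = coeff r 0"
  define c1 where "c1 = coeff r 1"
  note r = r [folded c0_def c1_def]
  have "poly (map_poly complex_of_real r) z = 0"
    using z mz by (subst (asm) pm) (simp add: map_poly_of_real_add map_poly_of_real_mult)
  then have "of_real c0 + z * of_real c1 = 0" by (simp add: r map_poly_pCons)
  then have "c1 = 0" "c0 = 0" using False by (auto simp: complex_eq_iff)
  then have "p = m * t" using pm r by simp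
  define N where "N = (norm z)\<^sup>2"
  have N: "N > 64" using power_strict_mono [OF large, of 2] by (simp add: N_def)
  show ?thesis
  proof (rule that)
    show "p = smult (1 / N) m * smult N t"
      using N \<open>p = m * t\<close> by simp
    show "coeff (smult (1 / N) m) 0 = 1" using N by (simp add: m_def flip: N_def)
    show "degree (smult (1 / N) m) > 0" using N by (simp add: m_def)
    have "norm z * 8 \<le> N" using large by (auto simp: N_def power2_eq_square intro: mult_left_mono)
    then have "2 * \<bar>Re z\<bar> \<le> N / 4" using abs_Re_le_cmod [of z] by linarith
    then have "N + (2 * \<bar>Re z\<bar> + 1) \<le> 3/2 * N" using N by linarith
    then show "l1_norm (smult (1 / N) m) \<le> 3/2"
      using N unfolding l1_norm_smult by (simp add: m_def l1_norm_pCons abs_mult field_simps flip: N_def)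
  qed
qed

text \<open>
The greedy bound uses the leading coefficient, which may be small although some other coefficient is
huge (as in \<open>X^3 - N X^2 + N X + 1\<close>).  A large root is responsible for this, and dividing by the factors
of large roots shifts the weight to the leading coefficient.  Each such factor costs a factor 2 in the
size of the solution and \<open>3/2\<close> in the norm, and lowers the degree, so that the powers of \<open>9 = 1 + 8\<close>
absorb it.
\<close>

lemma shift_op_small_solution_mod_Ints:
  fixes p :: "real poly" and s :: "nat \<Rightarrow> real"
  assumes "p \<noteq> 0"
  shows "\<exists>e. (\<forall>i. \<bar>e i\<bar> \<le> 9 ^ degree p / l1_norm p) \<and> (\<forall>i<n. shift_op p e i - s i \<in> \<int>)"
  using assms
proof (induction "degree p" arbitrary: p rule: less_induct)
  case less
  show ?case
  proof (cases "\<forall>z. poly (map_poly complex_of_real p) z = 0 \<longrightarrow> norm z \<le> 8")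
    case True
    then have "l1_norm p \<le> \<bar>lead_coeff p\<bar> * 9 ^ degree p"
      using l1_norm_le_lead_coeff [of "map_poly complex_of_real p" 8]
      by (simp add: l1_norm_of_real degree_map_poly coeff_map_poly)
    then have "1 / \<bar>lead_coeff p\<bar> \<le> 9 ^ degree p / l1_norm p"
      using less.prems l1_norm_pos [of p] by (simp add: field_simps)
    then show ?thesis
      using shift_op_greedy_mod_Ints [OF less.prems, of n s] by (meson order_trans)
  next
    case False
    then obtain z where "poly (map_poly complex_of_real p) z = 0" "norm z > 8" by force
    then obtain q r where qr: "p = q * r" "coeff q 0 = 1" "degree q > 0" "l1_norm q \<le> 3/2"
      using split_off_large_root less.prems by blast
    then have nz: "q \<noteq> 0" "r \<noteq> 0" using less.prems by auto
    then have deg: "degree p = degree q + degree r" using qr by (simp add: degree_mult_eq)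
    with qr(3) obtain g where g: "\<And>i. \<bar>g i\<bar> \<le> 9 ^ degree r / l1_norm r"
      "\<And>i. i < n \<Longrightarrow> shift_op r g i - s i \<in> \<int>"
      using less.hyps [of r] nz by auto
    have "\<exists>e. (\<forall>i. \<bar>e i\<bar> \<le> 2 * (9 ^ degree r / l1_norm r)) \<and>
            (\<forall>i<n + degree r. shift_op q e i = g i)"
      by (rule shift_op_solve_backward [OF qr(2,4) g(1)])
    then obtain e where e: "\<And>i. \<bar>e i\<bar> \<le> 2 * (9 ^ degree r / l1_norm r)"
      "\<And>i. i < n + degree r \<Longrightarrow> shift_op q e i = g i" by auto
    have "l1_norm p \<le> 3/2 * l1_norm r"
      using l1_norm_mult_le [of q r] qr(1,4) mult_right_mono [OF qr(4) l1_norm_nonneg [of r]] by simp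
    then have "2 * l1_norm p \<le> 9 * l1_norm r" using l1_norm_nonneg [of r] by linarith
    then have "2 * (9 ^ degree r / l1_norm r) \<le> 9 ^ Suc (degree r) / l1_norm p"
      using l1_norm_pos [OF nz(2)] l1_norm_pos [OF less.prems] by (simp add: field_simps)
    also have "\<dots> \<le> 9 ^ degree p / l1_norm p"
      using deg qr(3) l1_norm_pos [OF less.prems] by (intro divide_right_mono power_increasing) auto
    finally have "\<bar>e i\<bar> \<le> 9 ^ degree p / l1_norm p" for i using e(1) [of i] by linarith
    moreover have "shift_op p e i - s i \<in> \<int>" if "i < n" for i
    proof -
      have "shift_op p e i = shift_op r (shift_op q e) i"
        unfolding qr(1) by (subst mult.commute) (rule shift_op_mult)
      also have "\<dots> = shift_op r g i" by (rule shift_op_cong) (use e(2) that in auto)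
      finally show ?thesis using g(2) that by simp
    qed
    ultimately show ?thesis by blast
  qed
qed

section \<open>Recurrent sequences and Kronecker's theorem\<close>

text \<open>
All solutions of the recurrence, the powers of a root among them, depend on their initial values by
the same rational coefficients, whose denominators are powers of the leading coefficient.
\<close>

lemma linear_recurrence_expand:
  fixes P :: "int poly"
  assumes "degree P > 0" and "i < n + degree P"
  shows "\<exists>m :: nat \<Rightarrow> int. \<forall>x. (\<forall>l<n. shift_op (map_poly real_of_int P) x l = 0) \<longrightarrow>
           of_int (lead_coeff P ^ i) * x i = (\<Sum>j<degree P. of_int (m j) * x j)"
  using \<open>i < n + degree P\<close>
proof (induction i rule: less_induct)
  case (less i)
  let ?c = "lead_coeff P" and ?d = "degree P"
  let ?Z = "\<lambda>x. \<forall>l<n. shift_op (map_poly real_of_int P) x l = 0"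
  show ?case
  proof (cases "i < ?d")
    case True
    have "of_int (?c ^ i) * x i = (\<Sum>j<?d. of_int (if j = i then ?c ^ i else 0) * x j)" for x :: "nat \<Rightarrow> real"
    proof -
      have "(\<Sum>j<?d. of_int (if j = i then ?c ^ i else 0) * x j)
          = (\<Sum>j<?d. if j = i then of_int (?c ^ i) * x j else 0)"
        by (rule sum.cong) auto
      with True show ?thesis by simp
    qed
    then show ?thesis by (intro exI [of _ "\<lambda>j. if j = i then ?c ^ i else 0"]) blast
  next
    case False
    define l where "l = i - ?d"
    with False have i: "i = l + ?d" by simp
    then have "l < n" using less.prems by simp
    have "\<exists>m :: nat \<Rightarrow> int. j < ?d \<longrightarrow> (\<forall>x. ?Z x \<longrightarrow>
        of_int (?c ^ (l + j)) * x (l + j) = (\<Sum>r<?d. of_int (m r) * x r))" for j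
      using less.IH [of "l + j"] less.prems i by (cases "j < ?d") auto
    then obtain M :: "nat \<Rightarrow> nat \<Rightarrow> int" where M: "\<And>j x. j < ?d \<Longrightarrow> ?Z x \<Longrightarrow>
        of_int (?c ^ (l + j)) * x (l + j) = (\<Sum>r<?d. of_int (M j r) * x r)"
      by metis
    define m where "m r = (\<Sum>j<?d. - coeff P j * ?c ^ (?d - 1 - j) * M j r)" for r
    have "of_int (?c ^ i) * x i = (\<Sum>r<?d. of_int (m r) * x r)" if x: "?Z x" for x :: "nat \<Rightarrow> real"
    proof -
      have "shift_op (map_poly real_of_int P) x l = 0" using x \<open>l < n\<close> by blast
      then have *: "of_int ?c * x i = - (\<Sum>j<?d. of_int (coeff P j) * x (l + j))"
        by (simp add: shift_op_def degree_map_poly coeff_map_poly i flip: lessThan_Suc_atMost)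
      have "?c ^ i = ?c ^ (i - 1) * ?c"
        using \<open>degree P > 0\<close> i by (metis add_gr_0 power_minus_mult)
      then have "of_int (?c ^ i) * x i = of_int (?c ^ (i - 1)) * (of_int ?c * x i)" by simp
      also have "\<dots> = (\<Sum>j<?d. - of_int (coeff P j) * (of_int (?c ^ (i - 1)) * x (l + j)))"
        unfolding * by (simp add: sum_distrib_left sum_negf mult.left_commute)
      also have "\<dots> = (\<Sum>j<?d. - of_int (coeff P j) * of_int (?c ^ (?d - 1 - j)) * (\<Sum>r<?d. of_int (M j r) * x r))"
      proof (intro sum.cong refl)
        fix j assume "j \<in> {..<?d}"
        then have j: "j < ?d" by simp
        then have "i - 1 = (?d - 1 - j) + (l + j)" using i by simp
        then have "?c ^ (i - 1) = ?c ^ (?d - 1 - j) * ?c ^ (l + j)" by (simp only: power_add)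
        then have "of_int (?c ^ (i - 1)) * x (l + j) = of_int (?c ^ (?d - 1 - j)) * (of_int (?c ^ (l + j)) * x (l + j))"
          by simp
        then show "- of_int (coeff P j) * (of_int (?c ^ (i - 1)) * x (l + j))
            = - of_int (coeff P j) * of_int (?c ^ (?d - 1 - j)) * (\<Sum>r<?d. of_int (M j r) * x r)"
          unfolding M [OF j x] by simp
      qed
      also have "\<dots> = (\<Sum>j<?d. \<Sum>r<?d. of_int (- coeff P j * ?c ^ (?d - 1 - j) * M j r) * x r)"
        by (simp add: sum_distrib_left mult.assoc)
      also have "\<dots> = (\<Sum>r<?d. of_int (m r) * x r)"
        by (subst sum.swap) (simp add: m_def sum_distrib_right flip: sum_negf)
      finally show ?thesis .
    qed
    then show ?thesis by blast
  qed
qed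

lemma independent_powers:
  fixes a :: real
  assumes min: "\<And>Q :: int poly. Q \<noteq> 0 \<Longrightarrow> poly (map_poly of_int Q) a = 0 \<Longrightarrow> d \<le> degree Q"
  shows "inj_on (\<lambda>i. a ^ i) {..<d}"
    and "module.independent (\<lambda>r. (*) (real_of_int r)) ((\<lambda>i. a ^ i) ` {..<d})"
proof -
  interpret Modules.module "(\<lambda>r. (*) (real_of_int r))"
    by (simp add: Modules.module.intro distrib_left mult.commute)
  have zero: "f j = 0" if "(\<Sum>j<d. of_int (f j) * a ^ j) = 0" "j < d" for f :: "nat \<Rightarrow> int" and j
  proof -
    define Q :: "int poly" where "Q = Poly (map f [0..<d])"
    have cQ: "coeff Q j = (if j < d then f j else 0)" for j
      by (simp add: Q_def nth_default_def)
    have deg: "degree Q < d"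
      using \<open>j < d\<close> by (intro degree_lessI) (auto simp: cQ)
    have "poly (map_poly of_int Q) a = (\<Sum>j\<le>degree Q. of_int (coeff Q j) * a ^ j)"
      by (simp add: poly_altdef degree_map_poly coeff_map_poly)
    also have "\<dots> = (\<Sum>j<d. of_int (coeff Q j) * a ^ j)"
      using deg by (intro sum.mono_neutral_left) (auto simp: coeff_eq_0)
    also have "\<dots> = (\<Sum>j<d. of_int (f j) * a ^ j)"
      by (simp add: cQ)
    finally have "poly (map_poly of_int Q) a = 0" using that by simp
    with min [of Q] deg have "Q = 0" by (cases "Q = 0") auto
    then show "f j = 0" using cQ [of j] \<open>j < d\<close> by simp
  qed
  show inj: "inj_on (\<lambda>i. a ^ i) {..<d}"
  proof (rule inj_onI, rule ccontr)
    fix i k assume ik: "i \<in> {..<d}" "k \<in> {..<d}" "a ^ i = a ^ k" "i \<noteq> k"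
    define f :: "nat \<Rightarrow> int" where "f j = (if j = i then 1 else 0) - (if j = k then 1 else 0)" for j
    have "(\<Sum>j<d. of_int (f j) * a ^ j)
        = (\<Sum>j<d. (if j = i then a ^ j else 0)) - (\<Sum>j<d. (if j = k then a ^ j else 0))"
      unfolding sum_subtractf [symmetric] by (rule sum.cong) (auto simp: f_def)
    also have "\<dots> = 0" using ik by simp
    finally have "f i = 0" using zero ik by blast
    then show False using ik by (simp add: f_def)
  qed
  show "independent ((\<lambda>i. a ^ i) ` {..<d})"
    unfolding independent_explicit_module
  proof (intro allI impI)
    fix t u v
    assume t: "finite t" "t \<subseteq> (\<lambda>i. a ^ i) ` {..<d}" "(\<Sum>v\<in>t. of_int (u v) * v) = 0" "v \<in> t"
    then obtain j where j: "j < d" "v = a ^ j" by auto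
    define f where "f j = (if a ^ j \<in> t then u (a ^ j) else 0)" for j
    have "(\<Sum>j<d. of_int (f j) * a ^ j) = (\<Sum>j<d. (\<lambda>x. if x \<in> t then of_int (u x) * x else 0) (a ^ j))"
      by (rule sum.cong) (auto simp: f_def)
    also have "\<dots> = (\<Sum>x\<in>(\<lambda>i. a ^ i) ` {..<d}. if x \<in> t then of_int (u x) * x else 0)"
      by (simp only: sum.reindex [OF inj] o_def)
    also have "\<dots> = (\<Sum>v\<in>t. of_int (u v) * v)"
      using t by (intro sum.mono_neutral_cong_right) auto
    finally have "f j = 0" using zero t(3) j(1) by simp
    then show "u v = 0" using t(4) j by (simp add: f_def)
  qed
qed

text \<open>
Kronecker's theorem matches only the initial values \<open>w j\<close>, and a later entry depends on them with
coefficients in \<open>1/D\<close> times the integers.  Approximating \<open>w j / D\<close> modulo 1 by multiples of \<open>a^j\<close>, that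
is \<open>w j\<close> modulo \<open>D\<close>, keeps the later entries correct modulo 1.
\<close>

lemma recurrent_sequence_near_geometric:
  fixes P :: "int poly" and a :: real and w :: "nat \<Rightarrow> real"
  assumes root: "poly (map_poly of_int P) a = 0" and d: "degree P > 0"
    and min: "\<And>Q :: int poly. Q \<noteq> 0 \<Longrightarrow> poly (map_poly of_int Q) a = 0 \<Longrightarrow> degree P \<le> degree Q"
    and w: "\<And>i. i < n \<Longrightarrow> shift_op (map_poly real_of_int P) w i = 0"
    and \<epsilon>: "\<epsilon> > 0"
  shows "\<exists>\<xi>. \<forall>i<n. \<exists>h::int. \<bar>\<xi> * a ^ i - w i - of_int h\<bar> < \<epsilon>"
proof -
  let ?c = "lead_coeff P" and ?d = "degree P"
  let ?Z = "\<lambda>x. \<forall>l<n. shift_op (map_poly real_of_int P) x l = 0"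
  define D :: real where "D = of_int ?c ^ n"
  have D: "D \<noteq> 0" using d by (auto simp: D_def)
  have "\<exists>m :: nat \<Rightarrow> int. i < n \<longrightarrow> (\<forall>x. ?Z x \<longrightarrow> D * x i = (\<Sum>j<?d. of_int (m j) * x j))" for i
  proof (cases "i < n")
    case True
    then obtain m :: "nat \<Rightarrow> int" where m: "\<And>x. ?Z x \<Longrightarrow> of_int (?c ^ i) * x i = (\<Sum>j<?d. of_int (m j) * x j)"
      using linear_recurrence_expand [OF d, of i n] by auto
    have "D = of_int ?c ^ (n - i) * of_int ?c ^ i"
      using True by (simp add: D_def flip: power_add)
    then have "D * x i = (\<Sum>j<?d. of_int (?c ^ (n - i) * m j) * x j)" if "?Z x" for x :: "nat \<Rightarrow> real"
      using m [OF that] by (simp add: mult.assoc flip: sum_distrib_left)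
    then show ?thesis
      by (intro exI [of _ "\<lambda>j. ?c ^ (n - i) * m j"] impI allI)
  qed simp
  then have "\<exists>M :: nat \<Rightarrow> nat \<Rightarrow> int. \<forall>i. i < n \<longrightarrow> (\<forall>x. ?Z x \<longrightarrow> D * x i = (\<Sum>j<?d. of_int (M i j) * x j))"
    by (intro choice allI)
  then obtain M :: "nat \<Rightarrow> nat \<Rightarrow> int" where
    M: "\<And>i x. i < n \<Longrightarrow> ?Z x \<Longrightarrow> D * x i = (\<Sum>j<?d. of_int (M i j) * x j)"
    by blast
  define B where "B = 1 + (\<Sum>i<n. \<Sum>j<?d. \<bar>real_of_int (M i j)\<bar>)"
  have B: "B > 0" unfolding B_def by (intro add_pos_nonneg sum_nonneg) auto
  have inj: "inj_on (\<lambda>i. a ^ i) {..<?d}"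
    by (rule independent_powers, rule min)
  have indep: "module.independent (\<lambda>r. (*) (real_of_int r)) ((\<lambda>i. a ^ i) ` {..<?d})"
    by (rule independent_powers, rule min)
  have "\<epsilon> / B > 0" using B \<epsilon> by simp
  then obtain t h where th: "\<And>j. j < ?d \<Longrightarrow> \<bar>t * a ^ j - of_int (h j) - w j / D\<bar> < \<epsilon> / B"
    by (rule Kronecker_thm_1 [OF indep inj, where \<alpha> = "\<lambda>j. w j / D"]) blast
  have "\<bar>(t * D) * a ^ i - w i - of_int (\<Sum>j<?d. M i j * h j)\<bar> < \<epsilon>" if i: "i < n" for i
  proof -
    have Za: "?Z (\<lambda>i. a ^ i)" using root by (simp add: shift_op_power)
    have 1: "(t * D) * a ^ i = (\<Sum>j<?d. of_int (M i j) * (t * a ^ j))"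
      using M [OF i Za] by (simp add: sum_distrib_left mult.assoc mult.left_commute)
    have "w i = (D * w i) / D" using D by simp
    also have "\<dots> = (\<Sum>j<?d. of_int (M i j) * (w j / D))"
      using M [OF i] w by (simp add: sum_divide_distrib)
    finally have "(t * D) * a ^ i - w i - of_int (\<Sum>j<?d. M i j * h j)
        = (\<Sum>j<?d. of_int (M i j) * (t * a ^ j - of_int (h j) - w j / D))"
      unfolding 1 by (simp add: algebra_simps sum_subtractf sum.distrib)
    also have "\<bar>\<dots>\<bar> \<le> (\<Sum>j<?d. \<bar>of_int (M i j)\<bar> * (\<epsilon> / B))"
      by (rule order_trans [OF sum_abs], rule sum_mono)
        (simp only: abs_mult lessThan_iff, intro mult_left_mono less_imp_le th abs_ge_zero)
    also have "\<dots> = (\<Sum>j<?d. \<bar>real_of_int (M i j)\<bar>) * (\<epsilon> / B)"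
      by (rule sum_distrib_right [symmetric])
    also have "\<dots> < B * (\<epsilon> / B)"
    proof (rule mult_strict_right_mono)
      have "(\<Sum>j<?d. \<bar>real_of_int (M i j)\<bar>) \<le> (\<Sum>i<n. \<Sum>j<?d. \<bar>real_of_int (M i j)\<bar>)"
        using i by (intro member_le_sum [where f = "\<lambda>i. \<Sum>j<?d. \<bar>real_of_int (M i j)\<bar>"] sum_nonneg) auto
      then show "(\<Sum>j<?d. \<bar>real_of_int (M i j)\<bar>) < B" by (simp add: B_def)
    qed (use B \<epsilon> in simp)
    also have "\<dots> = \<epsilon>" using B by simp
    finally show ?thesis .
  qed
  then show ?thesis by blast
qed

text \<open>
For \<open>w = N + \<theta> + e\<close> the equation \<open>P(S) w = 0\<close> asks that \<open>P(S) e + \<theta> P(1)\<close> be the integer sequence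
\<open>-P(S) N\<close>.  The small solution makes the left side integral, surjectivity on integer sequences then
provides \<open>N\<close>, and \<open>w\<close> is replaced by a geometric sequence.  Half of \<open>\<epsilon>\<close> is spent on \<open>e\<close> and half on this
replacement.
\<close>

lemma powers_near_prescribed_residue:
  fixes P :: "int poly" and a \<theta> \<epsilon> :: real
  assumes prim: "content P = 1"
    and root: "poly (map_poly of_int P) a = 0" and d: "degree P > 0"
    and min: "\<And>Q :: int poly. Q \<noteq> 0 \<Longrightarrow> poly (map_poly of_int Q) a = 0 \<Longrightarrow> degree P \<le> degree Q"
    and large: "2 * 9 ^ degree P < \<epsilon> * l1_norm (map_poly real_of_int P)"
    and \<epsilon>: "\<epsilon> > 0"
  shows "\<exists>\<xi>. \<forall>i<n. \<exists>N::int. \<bar>\<xi> * a ^ i - of_int N - \<theta>\<bar> < \<epsilon>"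
proof -
  let ?R = "map_poly real_of_int P"
  have P0: "P \<noteq> 0" using d by auto
  then have R0: "?R \<noteq> 0" by (simp add: map_poly_eq_0_iff)
  have degR: "degree ?R = degree P" by (simp add: degree_map_poly)
  obtain e where e: "\<And>i. \<bar>e i\<bar> \<le> 9 ^ degree P / l1_norm ?R"
    "\<And>i. i < n \<Longrightarrow> shift_op ?R e i - (- \<theta> * poly ?R 1) \<in> \<int>"
    using shift_op_small_solution_mod_Ints [OF R0, of n "\<lambda>_. - \<theta> * poly ?R 1"] degR by auto
  have "9 ^ degree P / l1_norm ?R < \<epsilon> / 2"
    using large l1_norm_pos [OF R0] by (simp add: field_simps)
  then have e_small: "\<bar>e i\<bar> < \<epsilon> / 2" for i using e(1) [of i] by linarith
  have "\<exists>f::int. i < n \<longrightarrow> shift_op ?R e i + \<theta> * poly ?R 1 = of_int f" for i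
    using e(2) [of i] by (auto elim!: Ints_cases)
  then obtain f :: "nat \<Rightarrow> int" where f: "\<And>i. i < n \<Longrightarrow> shift_op ?R e i + \<theta> * poly ?R 1 = of_int (f i)"
    by metis
  have "\<exists>j. \<not> p dvd coeff P j" if "prime p" for p
    using that prim const_poly_dvd_iff_dvd_content [of p P] const_poly_dvd_iff [of p P] by fastforce
  then obtain N where N: "\<And>i. i < n \<Longrightarrow> shift_op P N i = - f i"
    using shift_op_surj_int [OF _ P0, of n "\<lambda>i. - f i"] by auto
  define w where "w i = of_int (N i) + (\<theta> + e i)" for i
  have "shift_op ?R w i = 0" if "i < n" for i
  proof -
    have "shift_op ?R w i = shift_op ?R (\<lambda>i. of_int (N i)) i + (shift_op ?R (\<lambda>_. \<theta>) i + shift_op ?R e i)"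
      unfolding w_def shift_op_plus ..
    then show ?thesis
      using f [OF that] N [OF that] unfolding shift_op_of_int shift_op_const by simp
  qed
  then obtain \<xi> where \<xi>: "\<And>i. i < n \<Longrightarrow> \<exists>h::int. \<bar>\<xi> * a ^ i - w i - of_int h\<bar> < \<epsilon> / 2"
    using recurrent_sequence_near_geometric [OF root d min, of n w "\<epsilon> / 2"] \<epsilon> by auto
  have "\<exists>N::int. \<bar>\<xi> * a ^ i - of_int N - \<theta>\<bar> < \<epsilon>" if i: "i < n" for i
  proof -
    obtain h :: int where "\<bar>\<xi> * a ^ i - w i - of_int h\<bar> < \<epsilon> / 2" using \<xi> [OF i] by blast
    then have "\<bar>\<xi> * a ^ i - of_int (N i + h) - \<theta>\<bar> < \<epsilon>"
      using e_small [of i] unfolding w_def of_int_add by linarith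
    then show ?thesis by blast
  qed
  then show ?thesis by blast
qed

section \<open>Algebraic numbers of bounded degree\<close>

lemma clear_denominators:
  fixes p :: "rat poly"
  shows "\<exists>(c::int) q :: int poly. c \<noteq> 0 \<and> map_poly of_int q = smult (of_int c) p"
proof (induction p)
  case 0
  show ?case by (rule exI [of _ 1], rule exI [of _ 0]) simp
next
  case (pCons r p)
  then obtain c :: int and q :: "int poly" where cq: "c \<noteq> 0" "map_poly of_int q = smult (of_int c) p"
    by blast
  obtain x y where r: "r = of_int x / of_int y" "y > 0"
    using quotient_of_unique [of r] quotient_of_div quotient_of_denom_pos by (metis surj_pair)
  have "map_poly of_int (pCons (c * x) (smult y q)) = smult (of_int (c * y)) (pCons r p)"
    using cq r by (simp add: map_poly_pCons map_poly_smult mult.commute)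
  moreover have "c * y \<noteq> 0" using cq r by simp
  ultimately show ?case by blast
qed

lemma algebraic_minimal_int_poly:
  assumes "algebraic a"
  obtains P :: "int poly" where "content P = 1" "poly (map_poly of_int P) a = 0"
    "degree P \<le> alg_degree a"
    "\<And>Q :: int poly. Q \<noteq> 0 \<Longrightarrow> poly (map_poly of_int Q) a = 0 \<Longrightarrow> degree P \<le> degree Q"
proof -
  let ?root = "\<lambda>Q :: int poly. Q \<noteq> 0 \<and> poly (map_poly of_int Q) a = 0"
  let ?deg = "\<lambda>n. \<exists>p :: rat poly. p \<noteq> 0 \<and> poly (map_poly of_rat p) a = 0 \<and> degree p = n"
  obtain p where p: "\<And>i. coeff p i \<in> \<int>" "p \<noteq> 0" "poly p a = 0"
    using algebraicE [OF assms] by blast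
  define p' where "p' = map_poly floor p"
  have p': "p = map_poly of_int p'"
    by (rule poly_eqI) (use p(1) in \<open>auto simp: p'_def coeff_map_poly elim: Ints_cases\<close>)
  have "map_poly of_rat (map_poly of_int p') = p"
    unfolding p' by (subst map_poly_map_poly) (auto simp: o_def)
  moreover have "map_poly rat_of_int p' \<noteq> 0" using p p' by (auto simp: map_poly_eq_0_iff)
  ultimately have "\<exists>n. ?deg n" using p(3) by metis
  then have "?deg (alg_degree a)" unfolding alg_degree_def by (rule LeastI_ex)
  then obtain r :: "rat poly" where r: "r \<noteq> 0" "poly (map_poly of_rat r) a = 0" "degree r = alg_degree a"
    by blast
  obtain c :: int and q :: "int poly" where cq: "c \<noteq> 0" "map_poly of_int q = smult (of_int c) r"
    using clear_denominators by blast
  have "map_poly real_of_int q = map_poly of_rat (map_poly of_int q)"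
    by (subst map_poly_map_poly) (auto simp: o_def)
  also have "\<dots> = smult (of_int c) (map_poly of_rat r)"
    unfolding cq by (intro poly_eqI) (simp add: coeff_map_poly of_rat_mult)
  finally have "poly (map_poly of_int q) a = 0" using r by simp
  moreover have "map_poly rat_of_int q \<noteq> 0" using cq r by simp
  then have "q \<noteq> 0" by auto
  moreover have "degree q = alg_degree a"
    using arg_cong [OF cq(2), of degree] cq(1) r(3) by (simp add: degree_map_poly)
  ultimately have q: "?root q" "degree q = alg_degree a" by auto
  define Q where "Q = arg_min degree ?root"
  have Q: "?root Q" "\<And>Q'. ?root Q' \<Longrightarrow> degree Q \<le> degree Q'"
    unfolding Q_def using arg_min_nat_lemma [of ?root q degree] q(1) by blast+
  define P where "P = primitive_part Q"
  have P: "Q = smult (content Q) P" "content P = 1" using Q by (simp_all add: P_def)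
  have "map_poly real_of_int Q = smult (of_int (content Q)) (map_poly of_int P)"
    by (subst P(1)) (simp add: map_poly_smult)
  with Q have "poly (map_poly of_int P) a = 0" by auto
  moreover have "degree P = degree Q"
    using Q(1) by (subst P(1)) simp
  ultimately show ?thesis using that [of P] P(2) Q(2) q by metis
qed

lemma finite_algebraic_bounded_l1_norm:
  "finite {a::real. \<exists>P :: int poly. P \<noteq> 0 \<and> degree P \<le> K \<and> l1_norm (map_poly real_of_int P) \<le> H
                      \<and> poly (map_poly of_int P) a = 0}" (is "finite ?A")
proof -
  define M where "M = \<lceil>H\<rceil>"
  define L where "L = {xs :: int list. set xs \<subseteq> {-M..M} \<and> length xs \<le> Suc K}"
  have "finite L" unfolding L_def by (rule finite_lists_length_le) simp
  have "?A \<subseteq> (\<Union>P\<in>{P \<in> Poly ` L. P \<noteq> 0}. {a. poly (map_poly of_int P) a = 0})"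
  proof clarify
    fix a and P :: "int poly"
    assume P: "P \<noteq> 0" "degree P \<le> K" "l1_norm (map_poly real_of_int P) \<le> H" "poly (map_poly of_int P) a = 0"
    have "\<bar>coeff P i\<bar> \<le> M" for i
    proof -
      have "\<bar>real_of_int (coeff P i)\<bar> \<le> l1_norm (map_poly real_of_int P)"
        using norm_coeff_le_l1_norm [of "map_poly real_of_int P" i] by (simp add: coeff_map_poly)
      then show ?thesis using P(3) unfolding M_def by linarith
    qed
    then have "set (coeffs P) \<subseteq> {-M..M}"
      by (auto simp: coeffs_def abs_le_iff minus_le_iff)
    then have "coeffs P \<in> L" using P by (simp add: L_def length_coeffs_degree)
    then have "P \<in> Poly ` L" by (metis Poly_coeffs image_eqI)
    with P show "a \<in> (\<Union>P\<in>{P \<in> Poly ` L. P \<noteq> 0}. {a. poly (map_poly of_int P) a = 0})" by blast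
  qed
  moreover have "finite \<dots>"
    using \<open>finite L\<close> by (auto intro!: poly_roots_finite simp: map_poly_eq_0_iff)
  ultimately show ?thesis by (rule finite_subset)
qed

section \<open>Difference systems and quantised outputs\<close>

lemma traj_diff:
  "traj a x0 u k - traj a x0' u' k = traj a (x0 - x0') (\<lambda>i. u i - u' i) k"
  by (induction k) (auto simp: algebra_simps)

lemma ULDI_imp_ULI:
  assumes "ULDI a U"
  shows "ULI a U"
proof -
  obtain k l where kl: "\<And>u u' z0 m. input_seq U u \<Longrightarrow> input_seq U u' \<Longrightarrow> distinct_seqs u u' \<Longrightarrow> m > l \<Longrightarrow>
      u m \<noteq> u' m \<Longrightarrow> diff_states a m (m + k) z0 (\<lambda>i. u i - u' i) \<notin> open_cube (k + 1)"
    using assms unfolding ULDI_def ULDI_in_def Let_def by (metis right_minus_eq)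
  have "outputs a m (m + k) x0 u \<noteq> outputs a m (m + k) x0' u'"
    if "input_seq U u" "input_seq U u'" "distinct_seqs u u'" "m > l" "u m \<noteq> u' m" for u u' x0 x0' m
  proof
    assume eq: "outputs a m (m + k) x0 u = outputs a m (m + k) x0' u'"
    have "\<bar>traj a (x0 - x0') (\<lambda>i. u i - u' i) i\<bar> < 1" if "i \<in> {m..m + k}" for i
    proof -
      have "i \<in> set [m..<Suc (m + k)]" using that by auto
      with eq have "\<lfloor>traj a x0 u i\<rfloor> = \<lfloor>traj a x0' u' i\<rfloor>"
        unfolding outputs_def map_eq_conv by blast
      then have "\<bar>traj a x0 u i - traj a x0' u' i\<bar> < 1" by linarith
      then show ?thesis by (simp only: traj_diff)
    qed
    then have "diff_states a m (m + k) (x0 - x0') (\<lambda>i. u i - u' i) \<in> open_cube (k + 1)"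
      by (auto simp: diff_states_def open_cube_def abs_less_iff minus_less_iff)
    with kl that show False by blast
  qed
  then show ?thesis unfolding ULI_def ULI_in_def by blast
qed

lemma ULDI_if_small:
  assumes gap: "\<And>u u'. u \<in> U \<Longrightarrow> u' \<in> U \<Longrightarrow> u \<noteq> u' \<Longrightarrow> g \<le> \<bar>u - u'\<bar>"
    and a: "\<bar>a\<bar> \<le> g - 1"
  shows "ULDI a U"
proof -
  have "diff_states a m (m + 1) z0 (\<lambda>i. u i - u' i) \<notin> open_cube (1 + 1)"
    if "input_seq U u" "input_seq U u'" "m > 0" "u m \<noteq> u' m" for u u' m z0
  proof
    let ?z = "traj a z0 (\<lambda>i. u i - u' i)"
    assume "diff_states a m (m + 1) z0 (\<lambda>i. u i - u' i) \<in> open_cube (1 + 1)"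
    then have z: "\<bar>?z m\<bar> < 1" "\<bar>?z (Suc m)\<bar> < 1"
      by (auto simp: diff_states_def open_cube_def abs_less_iff minus_less_iff simp del: traj.simps)
    have "\<bar>a * ?z m\<bar> \<le> g - 1"
      using mult_mono [OF a less_imp_le [OF z(1)]] a by (simp add: abs_mult)
    moreover have "?z (Suc m) = a * ?z m + (u m - u' m)" using that by simp
    moreover have "g \<le> \<bar>u m - u' m\<bar>" using that gap by (simp add: input_seq_def)
    ultimately show False using z(2) by linarith
  qed
  then have "ULDI_in 1 a U"
    unfolding ULDI_in_def Let_def by (intro exI [of _ 0]) auto
  then show ?thesis unfolding ULDI_def by blast
qed

text \<open>
The two trajectories are \<open>X \<plusminus> z / 2\<close>, where \<open>z\<close> is the orbit of the difference system with
\<open>\<bar>z\<bar> = g / (1 + \<bar>a\<bar>)\<close>.  Both inputs have the same mean \<open>\<mu>\<close> at all times, so the midpoints \<open>X\<close> follow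
an autonomous affine recursion.  Keeping them within \<open>\<epsilon>\<close> of the half-integers leaves room for
\<open>\<bar>z\<bar> / 2 \<le> 1/2 - \<epsilon>\<close> on either side.
\<close>

lemma not_ULI_if_powers_near:
  fixes a g \<epsilon> :: real
  assumes U: "w \<in> U" "w' \<in> U" "w - w' = g" and g: "g > 0" and a: "a \<noteq> 1"
    and \<epsilon>: "g / (1 + \<bar>a\<bar>) \<le> 1 - 2 * \<epsilon>"
    and near: "\<And>n \<theta>. \<exists>\<xi>. \<forall>i<n. \<exists>N::int. \<bar>\<xi> * a ^ i - of_int N - \<theta>\<bar> < \<epsilon>"
  shows "\<not> ULI a U"
proof
  assume "ULI a U"
  then obtain k l where kl: "\<And>u u' x0 x0' m. input_seq U u \<Longrightarrow> input_seq U u' \<Longrightarrow> distinct_seqs u u' \<Longrightarrow> m > l \<Longrightarrow>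
      u m \<noteq> u' m \<Longrightarrow> outputs a m (m + k) x0 u \<noteq> outputs a m (m + k) x0' u'"
    unfolding ULI_def ULI_in_def by blast
  \<comment> \<open>For negative \<open>a\<close> the inputs are constant and \<open>z\<close> is a fixed point; otherwise the inputs are
    exchanged at every step and \<open>z\<close> changes sign.\<close>
  define b where "b i = (a < 0 \<or> even i)" for i :: nat
  define u where "u i = (if b i then w else w')" for i
  define u' where "u' i = (if b i then w' else w)" for i
  define r where "r = g / (1 + \<bar>a\<bar>)"
  define z where "z i = (if a < 0 \<or> odd i then r else - r)" for i :: nat
  have r: "r > 0" "(1 + \<bar>a\<bar>) * r = g" using g by (simp_all add: r_def add_pos_nonneg)
  have z: "z (Suc i) = a * z i + (u i - u' i)" for i
    using r(2) U(3) by (auto simp: z_def u_def u'_def b_def algebra_simps abs_if split: if_splits)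
  define \<mu> where "\<mu> = (w + w') / 2"
  define X0 where "X0 = \<mu> / (1 - a)"
  have X0: "X0 = a * X0 + \<mu>" using a by (simp add: X0_def field_simps)
  obtain \<xi> where \<xi>: "\<And>i. i < Suc l + k + 1 \<Longrightarrow> \<exists>N::int. \<bar>\<xi> * a ^ i - of_int N - (1 / 2 - X0)\<bar> < \<epsilon>"
    using near by blast
  define X where "X i = X0 + \<xi> * a ^ i" for i
  have X: "X (Suc i) = a * X i + \<mu>" for i
    using X0 by (simp add: X_def algebra_simps)
  define x where "x i = X i + z i / 2" for i
  define x' where "x' i = X i - z i / 2" for i
  have mid: "u i = \<mu> + (u i - u' i) / 2" "u' i = \<mu> - (u i - u' i) / 2" for i
    by (simp_all add: u_def u'_def \<mu>_def field_simps)
  have step: "x (Suc i) = a * x i + u i" "x' (Suc i) = a * x' i + u' i" for i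
    unfolding x_def x'_def X z using mid [of i] by (simp_all add: field_simps)
  have traj: "traj a (x 1) u (Suc i) = x (Suc i)" "traj a (x' 1) u' (Suc i) = x' (Suc i)" for i
    by (induction i) (simp_all add: step)
  have same_floor: "\<lfloor>x i\<rfloor> = \<lfloor>x' i\<rfloor>" if i: "i < Suc l + k + 1" for i
  proof -
    obtain N :: int where N: "\<bar>\<xi> * a ^ i - of_int N - (1 / 2 - X0)\<bar> < \<epsilon>" using \<xi> [OF i] by blast
    have "\<bar>z i\<bar> \<le> 1 - 2 * \<epsilon>" using \<epsilon> r(1) by (simp add: z_def flip: r_def)
    with N have "of_int N < x i" "x i < of_int N + 1" "of_int N < x' i" "x' i < of_int N + 1"
      unfolding x_def x'_def X_def by linarith+
    then have "\<lfloor>x i\<rfloor> = N" "\<lfloor>x' i\<rfloor> = N" by (auto intro: floor_unique)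
    then show ?thesis by simp
  qed
  have traj_eq: "traj a (x 1) u i = x i" "traj a (x' 1) u' i = x' i" if "i > 0" for i
    using that traj [of "i - 1"] by (simp_all del: traj.simps)
  have "\<lfloor>traj a (x 1) u i\<rfloor> = \<lfloor>traj a (x' 1) u' i\<rfloor>" if "i \<in> set [Suc l..<Suc (Suc l + k)]" for i
  proof -
    have "i > 0" "i < Suc l + k + 1" using that by auto
    then show ?thesis using same_floor [of i] traj_eq [of i] by simp
  qed
  then have "outputs a (Suc l) (Suc l + k) (x 1) u = outputs a (Suc l) (Suc l + k) (x' 1) u'"
    unfolding outputs_def map_eq_conv by blast
  moreover have "input_seq U u" "input_seq U u'" using U by (simp_all add: input_seq_def u_def u'_def)
  moreover have "u (Suc l) \<noteq> u' (Suc l)" using U g by (auto simp: u_def u'_def)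
  moreover from this have "distinct_seqs u u'" unfolding distinct_seqs_def by (metis le_add1 plus_1_eq_Suc)
  ultimately show False using kl by blast
qed

lemma min_gap_attained:
  assumes "finite U" "x \<in> U" "y \<in> U" "x \<noteq> y"
  obtains w w' where "w \<in> U" "w' \<in> U" "w - w' = min_gap U" "min_gap U > 0"
    "\<And>u u'. u \<in> U \<Longrightarrow> u' \<in> U \<Longrightarrow> u \<noteq> u' \<Longrightarrow> min_gap U \<le> \<bar>u - u'\<bar>"
proof -
  let ?G = "{\<bar>v\<bar> | v. v \<in> diff_set U \<and> v \<noteq> 0}"
  have "?G \<subseteq> (\<lambda>(u, u'). \<bar>u - u'\<bar>) ` (U \<times> U)" by (auto simp: diff_set_def image_iff)
  then have fin: "finite ?G" by (rule finite_subset) (use assms in auto)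
  have mem: "\<bar>u - u'\<bar> \<in> ?G" if "u \<in> U" "u' \<in> U" "u \<noteq> u'" for u u'
  proof -
    have "u - u' \<in> diff_set U" using that unfolding diff_set_def by blast
    with that show ?thesis by force
  qed
  have "min_gap U \<in> ?G" unfolding min_gap_def using fin mem [OF assms(2-4)] by (intro Min_in) auto
  then obtain u u' where u: "u \<in> U" "u' \<in> U" "min_gap U = \<bar>u - u'\<bar>" "u \<noteq> u'"
    by (auto simp: diff_set_def)
  have le: "min_gap U \<le> \<bar>u - u'\<bar>" if "u \<in> U" "u' \<in> U" "u \<noteq> u'" for u u'
    unfolding min_gap_def using fin mem [OF that] by (rule Min_le)
  show ?thesis
  proof (cases "u > u'")
    case True
    with u le show ?thesis by (intro that [of u u']) auto
  next
    case False
    with u le show ?thesis by (intro that [of u' u]) auto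
  qed
qed

section \<open>The exceptional set\<close>

text \<open>
Beyond the distance \<open>\<delta>\<close> an exceptional \<open>a\<close> satisfies \<open>1 + \<bar>a\<bar> > g + \<delta>\<close>, so that
\<open>g / (1 + \<bar>a\<bar>)\<close> stays below \<open>g / (g + \<delta>) = 1 - 2 \<epsilon>\<close>.  This bound is uniform, even for large \<open>\<bar>a\<bar>\<close>, and
excludes all minimal polynomials of large norm.  The number 1 is set aside because the midpoint
recursion may have no fixed point there.
\<close>

lemma exceptional_set_finite_away:
  fixes U :: "real set"
  assumes "finite U" and "\<delta> > 0"
  shows "finite {a \<in> exceptional_set K U. \<bar>\<bar>a\<bar> - (min_gap U - 1)\<bar> > \<delta>}" (is "finite ?E")
proof (cases "\<exists>x\<in>U. \<exists>y\<in>U. x \<noteq> y")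
  case False
  then have "u m = u' m" if "input_seq U u" "input_seq U u'" "m > l" for u u' and m l :: nat
    using that by (auto simp: input_seq_def)
  then have "ULI a U" "ULDI a U" for a
    unfolding ULI_def ULI_in_def ULDI_def ULDI_in_def Let_def by auto
  then have "?E = {}" by (simp add: exceptional_set_def)
  then show ?thesis by (metis finite.emptyI)
next
  case True
  define g where "g = min_gap U"
  obtain w w' where w: "w \<in> U" "w' \<in> U" "w - w' = g" and g: "g > 0"
    and gap: "\<And>u u'. u \<in> U \<Longrightarrow> u' \<in> U \<Longrightarrow> u \<noteq> u' \<Longrightarrow> g \<le> \<bar>u - u'\<bar>"
    using True min_gap_attained [OF \<open>finite U\<close>] unfolding g_def by metis
  define \<epsilon> where "\<epsilon> = \<delta> / (2 * (g + \<delta>))"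
  have \<epsilon>: "\<epsilon> > 0" using g \<open>\<delta> > 0\<close> by (simp add: \<epsilon>_def)
  let ?B = "{a::real. \<exists>P :: int poly. P \<noteq> 0 \<and> degree P \<le> K
      \<and> l1_norm (map_poly real_of_int P) \<le> 2 * 9 ^ K / \<epsilon> \<and> poly (map_poly of_int P) a = 0}"
  have "?E \<subseteq> insert 1 ?B"
  proof
    fix a assume "a \<in> ?E"
    then have alg: "algebraic a" "alg_degree a \<le> K" and neq: "ULDI a U \<noteq> ULI a U"
      and far: "\<bar>\<bar>a\<bar> - (g - 1)\<bar> > \<delta>"
      by (auto simp: exceptional_set_def g_def)
    from neq have ULI: "ULI a U" and "\<not> ULDI a U" using ULDI_imp_ULI by blast+
    then have "\<not> \<bar>a\<bar> \<le> g - 1" using ULDI_if_small [OF gap] by blast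
    then have "1 + \<bar>a\<bar> > g + \<delta>" using far by linarith
    then have "g / (1 + \<bar>a\<bar>) \<le> g / (g + \<delta>)" using g \<open>\<delta> > 0\<close> by (intro divide_left_mono) auto
    also have "g / (g + \<delta>) = 1 - 2 * \<epsilon>" using g \<open>\<delta> > 0\<close> by (simp add: \<epsilon>_def field_simps)
    finally have ratio: "g / (1 + \<bar>a\<bar>) \<le> 1 - 2 * \<epsilon>" .
    obtain P :: "int poly" where P: "content P = 1" "poly (map_poly of_int P) a = 0" "degree P \<le> alg_degree a"
      "\<And>Q :: int poly. Q \<noteq> 0 \<Longrightarrow> poly (map_poly of_int Q) a = 0 \<Longrightarrow> degree P \<le> degree Q"
      using algebraic_minimal_int_poly [OF alg(1)] by blast
    have P0: "P \<noteq> 0" using P(1) by auto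
    have deg: "degree P > 0"
    proof (rule ccontr)
      assume "\<not> degree P > 0"
      then obtain c where "P = [:c:]" by (auto elim: degree_eq_zeroE)
      with P(2) P0 show False by (simp add: map_poly_pCons)
    qed
    show "a \<in> insert 1 ?B"
    proof (rule ccontr)
      assume "a \<notin> insert 1 ?B"
      then have "a \<noteq> 1" and "a \<notin> ?B" by auto
      have "l1_norm (map_poly real_of_int P) > 2 * 9 ^ K / \<epsilon>"
      proof (rule ccontr)
        assume "\<not> ?thesis"
        then have "degree P \<le> K" "l1_norm (map_poly real_of_int P) \<le> 2 * 9 ^ K / \<epsilon>"
          using P(3) alg(2) by auto
        with P0 P(2) have "a \<in> ?B" by blast
        with \<open>a \<notin> ?B\<close> show False ..
      qed
      then have "2 * 9 ^ K < \<epsilon> * l1_norm (map_poly real_of_int P)"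
        using \<epsilon> by (simp add: field_simps)
      moreover have "(9::real) ^ degree P \<le> 9 ^ K" using P(3) alg(2) by (intro power_increasing) auto
      ultimately have "2 * 9 ^ degree P < \<epsilon> * l1_norm (map_poly real_of_int P)" by linarith
      then have "\<not> ULI a U"
        using not_ULI_if_powers_near [OF w g \<open>a \<noteq> 1\<close> ratio] powers_near_prescribed_residue [OF P(1,2) deg P(4) _ \<epsilon>]
        by blast
      with ULI show False by blast
    qed
  qed
  then show ?thesis using finite_algebraic_bounded_l1_norm [of K "2 * 9 ^ K / \<epsilon>"] by (meson finite_insert finite_subset)
qed

theorem theorem5:
  fixes U :: "real set" and K :: nat
  assumes "finite U" and "K \<ge> 1"
  shows "(\<forall>a. a islimpt exceptional_set K U \<longrightarrow> \<bar>a\<bar> = min_gap U - 1) \<and>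
         (\<forall>\<delta>>0. finite {a \<in> exceptional_set K U. \<bar>\<bar>a\<bar> - (min_gap U - 1)\<bar> > \<delta>})"
proof (intro conjI allI impI)
  fix \<delta> :: real assume "\<delta> > 0"
  with assms(1) show "finite {a \<in> exceptional_set K U. \<bar>\<bar>a\<bar> - (min_gap U - 1)\<bar> > \<delta>}"
    by (rule exceptional_set_finite_away)
next
  fix a assume lim: "a islimpt exceptional_set K U"
  show "\<bar>a\<bar> = min_gap U - 1"
  proof (rule ccontr)
    assume "\<bar>a\<bar> \<noteq> min_gap U - 1"
    define \<delta> where "\<delta> = \<bar>\<bar>a\<bar> - (min_gap U - 1)\<bar> / 2"
    have \<delta>: "\<delta> > 0" using \<open>\<bar>a\<bar> \<noteq> min_gap U - 1\<close> by (simp add: \<delta>_def)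
    have "exceptional_set K U \<inter> ball a \<delta> \<subseteq> {a \<in> exceptional_set K U. \<bar>\<bar>a\<bar> - (min_gap U - 1)\<bar> > \<delta>}"
    proof
      fix b assume b: "b \<in> exceptional_set K U \<inter> ball a \<delta>"
      then have "\<bar>a - b\<bar> < \<delta>" by (simp add: dist_real_def)
      moreover have "\<bar>\<bar>a\<bar> - (min_gap U - 1)\<bar> = 2 * \<delta>" by (simp add: \<delta>_def)
      ultimately have "\<bar>\<bar>b\<bar> - (min_gap U - 1)\<bar> > \<delta>" by linarith
      with b show "b \<in> {a \<in> exceptional_set K U. \<bar>\<bar>a\<bar> - (min_gap U - 1)\<bar> > \<delta>}" by blast
    qed
    then have "finite (exceptional_set K U \<inter> ball a \<delta>)"
      using exceptional_set_finite_away [OF assms(1) \<delta>] finite_subset by blast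
    moreover have "infinite (exceptional_set K U \<inter> ball a \<delta>)"
      using lim \<delta> by (simp add: islimpt_eq_infinite_ball)
    ultimately show False by blast
  qed
qed

end
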